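(* Let $f:\mathbb{R}_{>0}^n\to\mathbb{R}_{>0}^n$ be a monotone homogeneous map. The following assertions are equivalent: (i) the two players do not have disjoint dominions in the game $\Gamma_\infty(f)$ (there is no pair of disjoint sets, one a dominion of Min and the other a dominion of Max); (ii) all the slice spaces $\mathcal{S}_\alpha^\beta(f)$, $\alpha,\beta>0$, are bounded in Hilbert's projective metric; (iii) for all diagonal matrices $D$ having positive diagonal entries, the map $Df$ has an eigenvector in $\mathbb{R}_{>0}^n$; (iv) for all diagonal matrices $D$ having positive diagonal entries, the limit $\lim_{k\to\infty}\big[(Df)^k(x)\big]_i^{1/k}$ exists for all $x\in\mathbb{R}_{>0}^n$ and all $i\in[n]$, and is independent of the choice of $x$ and $i$; (v) every monotone homogeneous map $g:\mathbb{R}_{>0}^n\to\mathbb{R}_{>0}^n$ that is a uniform perturbation of $f$ has an eigenvector in $\mathbb{R}_{>0}^n$; (vi) for every monotone homogeneous map $g:\mathbb{R}_{>0}^n\to\mathbb{R}_{>0}^n$ that is a uniform perturbation of $f$, the limit $\lim_{k\to\infty}\big[g^k(x)\big]_i^{1/k}$ exists for all $x\in\mathbb{R}_{>0}^n$ and all $i\in[n]$, and is independent of the choice of $x$ and $i$.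
   Context: $[n]=\{1,\dots,n\}$; $\mathbb{R}_{>0}^n$ is the set of vectors of $\mathbb{R}^n$ with all entries positive, with the componentwise order $\le$. A map $f:\mathbb{R}_{>0}^n\to\mathbb{R}_{>0}^n$ is monotone homogeneous if $x\le y\Rightarrow f(x)\le f(y)$ and $f(\lambda x)=\lambda f(x)$ for all $\lambda>0$. An eigenvector of such a map $h$ is $u\in\mathbb{R}_{>0}^n$ with $h(u)=\lambda u$ for some $\lambda>0$. $Df$ is the map $x\mapsto D\,f(x)$, and $g^k$ denotes the $k$th iterate. Hilbert's projective metric: $d_{\mathrm H}(x,y)=\log\inf\{\beta/\alpha \mid \alpha,\beta>0,\ \alpha x\le y\le\beta x\}$ for $x,y\in\mathbb{R}_{>0}^n$. Slice spaces: $\mathcal{S}_\alpha^\beta(f)=\{x\in\mathbb{R}_{>0}^n\mid \alpha x\le f(x)\le\beta x\}$. A monotone homogeneous map $g$ is a uniform perturbation of $f$ if there is a constant $\gamma\ge1$ and, for all $x\in\mathbb{R}_{>0}^n$, positive reals $\alpha_x,\beta_x$ with $\beta_x/\alpha_x\le\gamma$ and $\alpha_x f(x)\le g(x)\le\beta_x f(x)$. For $K\subset[n]$, $e_K\in\mathbb{R}^n$ is the vector with entries $1$ on $K$ and $0$ elsewhere, $K^c=[n]\setminus K$, and $\exp$ acts componentwise. Game $\Gamma_\infty(f)$: the state space is $[n]$. In state $i$, the actions of player Min are the sets $I\subset[n]$ such that $\lim_{\alpha\to+\infty} f_i(\exp(\alpha e_{I^c}))<+\infty$, and the actions of player Max are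 the sets $J\subset[n]$ such that $\lim_{\alpha\to-\infty} f_i(\exp(\alpha e_{J^c}))>0$. At each stage the players choose simultaneously actions $I$ and $J$ and the next state is drawn uniformly in $I\cap J$ (which is never empty). A dominion of a player is a nonempty set $\Delta\subset[n]$ such that from any initial state in $\Delta$ that player can force the state to remain almost surely in $\Delta$ at every stage, whatever the other player does; equivalently, a nonempty $\Delta$ such that for every $i\in\Delta$ the set $\Delta$ is itself an action of that player in state $i$. *)

theory Defs
  imports "HOL-Probability.Probability"
begin

text \<open>
  Vectors of \<open>\<real>\<^sup>n\<close> have type \<open>real ^ 'n\<close>, with index set \<open>[n] = UNIV :: 'n set\<close>; \<open>\<le>\<close> on this type
  is the componentwise order. Maps of the open positive cone are total functions on
  \<open>real ^ 'n\<close>, and their values outside the cone are never used.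
\<close>

definition pos_cone :: "(real ^ 'n) set" where
  "pos_cone = {x. \<forall>i. 0 < x $ i}"

definition monotone_homogeneous :: "(real ^ 'n \<Rightarrow> real ^ 'n) \<Rightarrow> bool" where
  "monotone_homogeneous f \<longleftrightarrow>
     f \<in> pos_cone \<rightarrow> pos_cone \<and>
     mono_on pos_cone f \<and>
     (\<forall>x\<in>pos_cone. \<forall>c>0. f (c *\<^sub>R x) = c *\<^sub>R f x)"

definition has_eigenvector :: "(real ^ 'n \<Rightarrow> real ^ 'n) \<Rightarrow> bool" where
  "has_eigenvector h \<longleftrightarrow> (\<exists>u\<in>pos_cone. \<exists>c>0. h u = c *\<^sub>R u)"

definition hilbert_dist :: "real ^ 'n \<Rightarrow> real ^ 'n \<Rightarrow> real" where
  "hilbert_dist x y =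
     ln (Inf {b / a | a b. 0 < a \<and> 0 < b \<and> a *\<^sub>R x \<le> y \<and> y \<le> b *\<^sub>R x})"

definition hilbert_bounded :: "(real ^ 'n) set \<Rightarrow> bool" where
  "hilbert_bounded S \<longleftrightarrow> (\<exists>M. \<forall>x\<in>S. \<forall>y\<in>S. hilbert_dist x y \<le> M)"

definition slice_space :: "(real ^ 'n \<Rightarrow> real ^ 'n) \<Rightarrow> real \<Rightarrow> real \<Rightarrow> (real ^ 'n) set" where
  "slice_space f a b = {x \<in> pos_cone. a *\<^sub>R x \<le> f x \<and> f x \<le> b *\<^sub>R x}"

definition uniform_perturbation ::
    "(real ^ 'n \<Rightarrow> real ^ 'n) \<Rightarrow> (real ^ 'n \<Rightarrow> real ^ 'n) \<Rightarrow> bool" where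
  "uniform_perturbation f g \<longleftrightarrow>
     (\<exists>c\<ge>1. \<forall>x\<in>pos_cone. \<exists>a>0. \<exists>b>0. b / a \<le> c \<and> a *\<^sub>R f x \<le> g x \<and> g x \<le> b *\<^sub>R f x)"

definition positive_diagonal :: "real ^ 'n ^ 'n \<Rightarrow> bool" where
  "positive_diagonal D \<longleftrightarrow> (\<forall>i j. i \<noteq> j \<longrightarrow> D $ i $ j = 0) \<and> (\<forall>i. 0 < D $ i $ i)"

definition uniform_growth_rate :: "(real ^ 'n \<Rightarrow> real ^ 'n) \<Rightarrow> bool" where
  "uniform_growth_rate h \<longleftrightarrow>
     (\<exists>L::real. \<forall>x\<in>pos_cone. \<forall>i.
        (\<lambda>k::nat. ((h ^^ k) x $ i) powr (1 / real k)) \<longlonglongrightarrow> L)"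

definition indicator_vec :: "'n set \<Rightarrow> real ^ 'n" where
  "indicator_vec K = (\<chi> i. if i \<in> K then 1 else 0)"

definition exp_vec :: "real ^ 'n \<Rightarrow> real ^ 'n" where
  "exp_vec x = (\<chi> i. exp (x $ i))"

text \<open>
  The limit defining an action of Min is taken in the extended reals, since the monotone
  function under the limit may diverge to \<open>\<infinity>\<close>. The one defining an action of Max is a limit of
  positive values decreasing as the parameter goes to \<open>-\<infinity>\<close>, hence always a real number.
\<close>

definition min_actions :: "(real ^ 'n \<Rightarrow> real ^ 'n) \<Rightarrow> 'n \<Rightarrow> 'n set set" where
  "min_actions f i =
     {I. \<exists>L::ereal. ((\<lambda>a. ereal (f (exp_vec (a *\<^sub>R indicator_vec (- I))) $ i)) \<longlongrightarrow> L) at_top \<and> L < \<infinity>}"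

definition max_actions :: "(real ^ 'n \<Rightarrow> real ^ 'n) \<Rightarrow> 'n \<Rightarrow> 'n set set" where
  "max_actions f i =
     {J. \<exists>L::real. ((\<lambda>a. f (exp_vec (a *\<^sub>R indicator_vec (- J))) $ i) \<longlongrightarrow> L) at_bot \<and> 0 < L}"

text \<open>
  A history lists the past stages as triples (state, action of Min, action of Max). Strategies
  are behavioural: they map the history and the current state to a probability distribution
  over actions.
\<close>

type_synonym 'n history = "('n \<times> 'n set \<times> 'n set) list"
type_synonym 'n strategy = "'n history \<Rightarrow> 'n \<Rightarrow> 'n set pmf"

definition strategies :: "('n \<Rightarrow> 'n set set) \<Rightarrow> 'n strategy set" where
  "strategies A = {\<sigma>. \<forall>h i. set_pmf (\<sigma> h i) \<subseteq> A i}"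

text \<open>
  \<open>play \<sigma> \<tau> i k\<close> is the joint law of the history before stage \<open>k\<close> and the state at stage \<open>k\<close>, when
  the initial state is \<open>i\<close> and Min and Max use \<open>\<sigma>\<close> and \<open>\<tau>\<close>. The two actions are drawn
  independently given the history, which renders the simultaneous choice. If \<open>I\<close> and \<open>J\<close> are
  available actions in the same state, \<open>I \<inter> J\<close> is nonempty, so \<open>pmf_of_set\<close> is the uniform law.
\<close>

primrec play :: "'n::finite strategy \<Rightarrow> 'n strategy \<Rightarrow> 'n \<Rightarrow> nat \<Rightarrow> ('n history \<times> 'n) pmf" where
  "play \<sigma> \<tau> i 0 = return_pmf ([], i)"
| "play \<sigma> \<tau> i (Suc k) =
     bind_pmf (play \<sigma> \<tau> i k) (\<lambda>(h, s).
       bind_pmf (pair_pmf (\<sigma> h s) (\<tau> h s)) (\<lambda>(I, J).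
         map_pmf (\<lambda>t. (h @ [(s, I, J)], t)) (pmf_of_set (I \<inter> J))))"

text \<open>
  Remaining almost surely in \<open>\<Delta>\<close> at every stage is expressed stage by stage; as there are
  countably many stages, this is the same as almost surely never leaving \<open>\<Delta>\<close>.
\<close>

definition stays_in :: "'n::finite strategy \<Rightarrow> 'n strategy \<Rightarrow> 'n \<Rightarrow> 'n set \<Rightarrow> bool" where
  "stays_in \<sigma> \<tau> i \<Delta> \<longleftrightarrow> (\<forall>k. AE (h, s) in measure_pmf (play \<sigma> \<tau> i k). s \<in> \<Delta>)"

definition min_dominion :: "(real ^ 'n \<Rightarrow> real ^ 'n) \<Rightarrow> 'n::finite set \<Rightarrow> bool" where
  "min_dominion f \<Delta> \<longleftrightarrow> \<Delta> \<noteq> {} \<and>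
     (\<forall>i\<in>\<Delta>. \<exists>\<sigma>\<in>strategies (min_actions f). \<forall>\<tau>\<in>strategies (max_actions f). stays_in \<sigma> \<tau> i \<Delta>)"

definition max_dominion :: "(real ^ 'n \<Rightarrow> real ^ 'n) \<Rightarrow> 'n::finite set \<Rightarrow> bool" where
  "max_dominion f \<Delta> \<longleftrightarrow> \<Delta> \<noteq> {} \<and>
     (\<forall>i\<in>\<Delta>. \<exists>\<tau>\<in>strategies (max_actions f). \<forall>\<sigma>\<in>strategies (min_actions f). stays_in \<sigma> \<tau> i \<Delta>)"

end

theory Submission
  imports Defs
begin

text \<open>
  A set \<open>I\<close> is an action of Min in state \<open>i\<close> exactly when the \<open>i\<close>-th coordinate of \<open>f\<close> is bounded
  above on the vectors that are at most \<open>1\<close> on \<open>I\<close>, and an action of Max when it is bounded below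
  by a positive constant on the vectors that are at least \<open>1\<close> on it (\<open>min_actions_iff\<close>,
  \<open>max_actions_iff\<close>). A dominion of Min is thus a set of coordinates on which \<open>f\<close> is controlled
  from above by these coordinates alone, and a dominion of Max one on which it is controlled from
  below by these coordinates alone. The equivalence is a cycle of implications around this
  observation.

  If a slice space contains points whose largest and smallest entries have arbitrarily large
  ratio, the coordinates that stay comparable to the smallest entry and those that stay comparable
  to the largest one form disjoint dominions of Min and of Max
  (\<open>unbounded_slice_gives_disjoint_dominions\<close>). Hence the absence of disjoint dominions makes all
  slice spaces bounded.

  Boundedness of all slice spaces passes to uniform perturbations (\<open>bounded_slices_perturbation\<close>),
  and it gives an eigenvector by a vanishing discount argument
  (\<open>bounded_slices_imp_eigenvector\<close>): in logarithmic coordinates \<open>f\<close> becomes a map \<open>T\<close> commuting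
  with the addition of constants, the discounted equations \<open>T v = (1 + \<epsilon>) v\<close> have solutions with
  \<open>\<epsilon> v\<close> bounded, so these solutions lie in one slice space; its boundedness forces the limit
  points of \<open>T v - v = \<epsilon> v\<close> to be constant vectors.

  An eigenvector determines the growth rate, because every orbit is squeezed between two multiples
  of the orbit of the eigenvector (\<open>eigenvector_imp_growth_rate\<close>). Diagonal scalings are uniform
  perturbations. Finally, if there were disjoint dominions, a diagonal matrix could slow down \<open>f\<close> on
  the one of Min and accelerate it on the one of Max, so that the growth rates on them
  would differ (\<open>disjoint_dominions_imp_no_growth_rate\<close>).
\<close>

section \<open>Monotone homogeneous maps\<close>

lemma in_pos_coneD: "x \<in> pos_cone \<Longrightarrow> 0 < x $ i"
  by (simp add: pos_cone_def)

lemma one_in_pos_cone: "1 \<in> pos_cone"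
  by (simp add: pos_cone_def)

lemma scaleR_in_pos_cone: "x \<in> pos_cone \<Longrightarrow> 0 < c \<Longrightarrow> c *\<^sub>R x \<in> pos_cone"
  by (simp add: pos_cone_def)

lemma max_entry: "\<exists>i. \<forall>j. x $ j \<le> x $ i" for x :: "real ^ 'n"
proof -
  have "Max (range (($) x)) \<in> range (($) x)"
    by (rule Max_in) auto
  then obtain i where "Max (range (($) x)) = x $ i"
    by blast
  moreover have "x $ j \<le> Max (range (($) x))" for j
    by (rule Max_ge) auto
  ultimately show ?thesis
    by auto
qed

lemma min_entry: "\<exists>i. \<forall>j. x $ i \<le> x $ j" for x :: "real ^ 'n"
  using max_entry[of "- x"] by simp

lemma pos_cone_bounds:
  fixes x :: "real ^ 'n"
  assumes "x \<in> pos_cone"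
  shows "\<exists>m>0. \<exists>M>0. \<forall>i. m \<le> x $ i \<and> x $ i \<le> M"
  using max_entry[of x] min_entry[of x] in_pos_coneD[OF assms] by blast

lemma monotone_homogeneousD:
  assumes "monotone_homogeneous f" and "x \<in> pos_cone"
  shows monotone_homogeneous_in_cone: "f x \<in> pos_cone"
    and monotone_homogeneous_scale: "0 < c \<Longrightarrow> f (c *\<^sub>R x) = c *\<^sub>R f x"
    and monotone_homogeneous_mono: "y \<in> pos_cone \<Longrightarrow> x \<le> y \<Longrightarrow> f x \<le> f y"
  using assms by (auto simp: monotone_homogeneous_def dest: mono_onD)

lemma monotone_homogeneous_scaled_mono:
  assumes f: "monotone_homogeneous f" and xy: "x \<in> pos_cone" "y \<in> pos_cone" and c: "0 < c"
  shows "x \<le> c *\<^sub>R y \<Longrightarrow> f x \<le> c *\<^sub>R f y" and "c *\<^sub>R x \<le> y \<Longrightarrow> c *\<^sub>R f x \<le> f y"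
  using monotone_homogeneous_mono[OF f xy(1) scaleR_in_pos_cone[OF xy(2) c]]
    monotone_homogeneous_mono[OF f scaleR_in_pos_cone[OF xy(1) c] xy(2)]
    monotone_homogeneous_scale[OF f xy(1) c] monotone_homogeneous_scale[OF f xy(2) c]
  by simp_all

lemma monotone_homogeneous_funpow_in_cone:
  assumes "monotone_homogeneous f" and "x \<in> pos_cone"
  shows "(f ^^ k) x \<in> pos_cone"
  by (induction k) (simp_all add: assms monotone_homogeneous_in_cone[OF assms(1)])

text \<open>
  A point close to \<open>a\<close> lies between \<open>c *\<^sub>R a\<close> and \<open>d *\<^sub>R a\<close> with \<open>c\<close>, \<open>d\<close> close to \<open>1\<close>, and the
  map preserves these bounds.
\<close>

lemma monotone_homogeneous_continuous_on:
  fixes f :: "real ^ 'n \<Rightarrow> real ^ 'n"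
  assumes f: "monotone_homogeneous f"
  shows "continuous_on pos_cone f"
  unfolding continuous_on_def
proof (intro ballI vec_tendstoI order_tendstoI)
  fix a :: "real ^ 'n" and i b
  assume a: "a \<in> pos_cone"
  let ?F = "at a within pos_cone"
  have fa: "0 < f a $ i"
    by (rule in_pos_coneD[OF monotone_homogeneous_in_cone[OF f a]])
  have cone: "eventually (\<lambda>x. x \<in> pos_cone) ?F"
    by (simp add: eventually_at_filter)
  have lim: "((\<lambda>x. x $ j) \<longlongrightarrow> a $ j) ?F" for j
    by (intro tendsto_intros)
  {
    assume "b < f a $ i"
    then have "max 0 (b / f a $ i) < 1"
      using fa by simp
    then obtain c where c: "max 0 (b / f a $ i) < c" "c < 1"
      using dense by blast
    have "eventually (\<lambda>x. \<forall>j. c * a $ j < x $ j) ?F"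
      using c in_pos_coneD[OF a] by (intro eventually_all_finite order_tendstoD(1)[OF lim]) simp
    then show "eventually (\<lambda>x. b < f x $ i) ?F"
      using cone
    proof eventually_elim
      case (elim x)
      then have "c *\<^sub>R f a \<le> f x"
        using c by (intro monotone_homogeneous_scaled_mono(2)[OF f a])
          (auto simp: less_eq_vec_def less_imp_le)
      then have "c * f a $ i \<le> f x $ i"
        by (auto simp: less_eq_vec_def)
      moreover have "b < c * f a $ i"
        using c fa by (simp add: divide_less_eq)
      ultimately show ?case
        by simp
    qed
  }
  {
    assume "f a $ i < b"
    then have "1 < b / f a $ i"
      using fa by simp
    then obtain c where c: "1 < c" "c < b / f a $ i"
      using dense by blast
    have "eventually (\<lambda>x. \<forall>j. x $ j < c * a $ j) ?F"
      using c in_pos_coneD[OF a] by (intro eventually_all_finite order_tendstoD(2)[OF lim]) simp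
    then show "eventually (\<lambda>x. f x $ i < b) ?F"
      using cone
    proof eventually_elim
      case (elim x)
      then have "f x \<le> c *\<^sub>R f a"
        using c by (intro monotone_homogeneous_scaled_mono(1)[OF f _ a])
          (auto simp: less_eq_vec_def less_imp_le)
      then have "f x $ i \<le> c * f a $ i"
        by (auto simp: less_eq_vec_def)
      moreover have "c * f a $ i < b"
        using c fa by (simp add: less_divide_eq)
      ultimately show ?case
        by simp
    qed
  }
qed

section \<open>Actions and dominions\<close>

text \<open>
  The points \<open>exp_vec (a *\<^sub>R indicator_vec (- I))\<close> equal \<open>1\<close> on \<open>I\<close>, and for large \<open>a\<close> they
  dominate any given vector that is at most \<open>1\<close> on \<open>I\<close>. By monotonicity the limit is therefore
  the supremum of the values of \<open>f\<close> at all such vectors.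
\<close>

lemma min_actions_iff:
  fixes f :: "real ^ 'n \<Rightarrow> real ^ 'n"
  assumes f: "monotone_homogeneous f"
  shows "I \<in> min_actions f i \<longleftrightarrow>
    (\<exists>C. \<forall>x\<in>pos_cone. (\<forall>j\<in>I. x $ j \<le> 1) \<longrightarrow> f x $ i \<le> C)"
proof -
  define p :: "real \<Rightarrow> real ^ 'n" where "p a = exp_vec (a *\<^sub>R indicator_vec (- I))" for a
  have p_nth: "p a $ j = (if j \<in> I then 1 else exp a)" for a j
    by (simp add: p_def exp_vec_def indicator_vec_def)
  have p_cone: "p a \<in> pos_cone" for a
    by (simp add: pos_cone_def p_nth)
  have mono: "f (p a) $ i \<le> f (p b) $ i" if "a \<le> b" for a b
    using monotone_homogeneous_mono[OF f p_cone p_cone, of a b] that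
    by (auto simp: less_eq_vec_def p_nth)
  show ?thesis
  proof
    assume "I \<in> min_actions f i"
    then obtain L where L: "((\<lambda>a. ereal (f (p a) $ i)) \<longlongrightarrow> L) at_top" "L < \<infinity>"
      by (auto simp: min_actions_def p_def)
    have le: "ereal (f (p a) $ i) \<le> L" for a
    proof (rule tendsto_lowerbound[OF L(1)])
      show "eventually (\<lambda>b. ereal (f (p a) $ i) \<le> ereal (f (p b) $ i)) at_top"
        using eventually_ge_at_top[of a] by eventually_elim (simp add: mono)
    qed simp
    obtain C where C: "L = ereal C"
      using L(2) le[of 0] by (cases L) auto
    have "f x $ i \<le> C" if x: "x \<in> pos_cone" "\<forall>j\<in>I. x $ j \<le> 1" for x
    proof -
      obtain m M where m: "0 < m" "\<And>j. m \<le> x $ j" and M: "0 < M" "\<And>j. x $ j \<le> M"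
        using pos_cone_bounds[OF x(1)] by blast
      have "x \<le> p (ln M)"
        using x M by (auto simp: less_eq_vec_def p_nth)
      then have "f x $ i \<le> f (p (ln M)) $ i"
        using monotone_homogeneous_mono[OF f x(1) p_cone] by (simp add: less_eq_vec_def)
      also have "\<dots> \<le> C"
        using le[of "ln M"] C by simp
      finally show ?thesis .
    qed
    then show "\<exists>C. \<forall>x\<in>pos_cone. (\<forall>j\<in>I. x $ j \<le> 1) \<longrightarrow> f x $ i \<le> C"
      by blast
  next
    assume "\<exists>C. \<forall>x\<in>pos_cone. (\<forall>j\<in>I. x $ j \<le> 1) \<longrightarrow> f x $ i \<le> C"
    then obtain C where "\<And>x. x \<in> pos_cone \<Longrightarrow> \<forall>j\<in>I. x $ j \<le> 1 \<Longrightarrow> f x $ i \<le> C"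
      by blast
    then have C: "f (p a) $ i \<le> C" for a
      using p_cone by (auto simp: p_nth)
    let ?L = "SUP a. ereal (f (p a) $ i)"
    have "((\<lambda>a. ereal (f (p a) $ i)) \<longlongrightarrow> ?L) at_top"
    proof (rule order_tendstoI)
      fix b
      assume "b < ?L"
      then obtain a where a: "b < ereal (f (p a) $ i)"
        by (auto simp: less_SUP_iff)
      show "eventually (\<lambda>x. b < ereal (f (p x) $ i)) at_top"
        using eventually_ge_at_top[of a]
        by eventually_elim (use a mono in \<open>auto intro: less_le_trans\<close>)
    next
      fix b
      assume "?L < b"
      moreover have "ereal (f (p x) $ i) \<le> ?L" for x
        by (rule SUP_upper) simp
      ultimately show "eventually (\<lambda>x. ereal (f (p x) $ i) < b) at_top"
        by (intro always_eventually) (meson le_less_trans)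
    qed
    moreover have "?L \<le> ereal C"
      by (rule SUP_least) (simp add: C)
    then have "?L < \<infinity>"
      by (auto intro: le_less_trans)
    ultimately show "I \<in> min_actions f i"
      unfolding min_actions_def p_def by blast
  qed
qed

lemma max_actions_iff:
  fixes f :: "real ^ 'n \<Rightarrow> real ^ 'n"
  assumes f: "monotone_homogeneous f"
  shows "J \<in> max_actions f i \<longleftrightarrow>
    (\<exists>c>0. \<forall>x\<in>pos_cone. (\<forall>j\<in>J. 1 \<le> x $ j) \<longrightarrow> c \<le> f x $ i)"
proof -
  define p :: "real \<Rightarrow> real ^ 'n" where "p a = exp_vec (a *\<^sub>R indicator_vec (- J))" for a
  have p_nth: "p a $ j = (if j \<in> J then 1 else exp a)" for a j
    by (simp add: p_def exp_vec_def indicator_vec_def)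
  have p_cone: "p a \<in> pos_cone" for a
    by (simp add: pos_cone_def p_nth)
  have mono: "f (p a) $ i \<le> f (p b) $ i" if "a \<le> b" for a b
    using monotone_homogeneous_mono[OF f p_cone p_cone, of a b] that
    by (auto simp: less_eq_vec_def p_nth)
  show ?thesis
  proof
    assume "J \<in> max_actions f i"
    then obtain c where c: "((\<lambda>a. f (p a) $ i) \<longlongrightarrow> c) at_bot" "0 < c"
      by (auto simp: max_actions_def p_def)
    have le: "c \<le> f (p a) $ i" for a
    proof (rule tendsto_upperbound[OF c(1)])
      show "eventually (\<lambda>b. f (p b) $ i \<le> f (p a) $ i) at_bot"
        using eventually_le_at_bot[of a] by eventually_elim (simp add: mono)
    qed simp
    have "c \<le> f x $ i" if x: "x \<in> pos_cone" "\<forall>j\<in>J. 1 \<le> x $ j" for x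
    proof -
      obtain m M where m: "0 < m" "\<And>j. m \<le> x $ j" and M: "0 < M" "\<And>j. x $ j \<le> M"
        using pos_cone_bounds[OF x(1)] by blast
      have "p (ln m) \<le> x"
        using x m by (auto simp: less_eq_vec_def p_nth)
      then have "f (p (ln m)) $ i \<le> f x $ i"
        using monotone_homogeneous_mono[OF f p_cone x(1)] by (simp add: less_eq_vec_def)
      with le[of "ln m"] show ?thesis
        by simp
    qed
    with c(2) show "\<exists>c>0. \<forall>x\<in>pos_cone. (\<forall>j\<in>J. 1 \<le> x $ j) \<longrightarrow> c \<le> f x $ i"
      by blast
  next
    assume "\<exists>c>0. \<forall>x\<in>pos_cone. (\<forall>j\<in>J. 1 \<le> x $ j) \<longrightarrow> c \<le> f x $ i"
    then obtain c where "0 < c" "\<And>x. x \<in> pos_cone \<Longrightarrow> \<forall>j\<in>J. 1 \<le> x $ j \<Longrightarrow> c \<le> f x $ i"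
      by blast
    then have c: "0 < c" "c \<le> f (p a) $ i" for a
      using p_cone by (auto simp: p_nth)
    let ?L = "INF a. f (p a) $ i"
    have bdd: "bdd_below (range (\<lambda>a. f (p a) $ i))"
      using c(2) by (auto intro!: bdd_belowI)
    have "((\<lambda>a. f (p a) $ i) \<longlongrightarrow> ?L) at_bot"
    proof (rule order_tendstoI)
      fix b
      assume "?L < b"
      then obtain a where a: "f (p a) $ i < b"
        using bdd by (auto simp: cINF_less_iff)
      show "eventually (\<lambda>x. f (p x) $ i < b) at_bot"
        using eventually_le_at_bot[of a]
        by eventually_elim (use a mono in \<open>auto intro: le_less_trans\<close>)
    next
      fix b
      assume "b < ?L"
      moreover have "?L \<le> f (p x) $ i" for x
        by (rule cINF_lower[OF bdd]) simp
      ultimately show "eventually (\<lambda>x. b < f (p x) $ i) at_bot"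
        by (intro always_eventually) (meson less_le_trans)
    qed
    moreover have "c \<le> ?L"
      by (rule cINF_greatest) (auto simp: c)
    ultimately show "J \<in> max_actions f i"
      unfolding max_actions_def p_def using c(1) by force
  qed
qed

lemma UNIV_in_min_actions:
  assumes f: "monotone_homogeneous f"
  shows "UNIV \<in> min_actions f i"
  unfolding min_actions_iff[OF f]
proof (intro exI ballI impI)
  fix x :: "real ^ 'a"
  assume "x \<in> pos_cone" "\<forall>j\<in>UNIV. x $ j \<le> 1"
  then show "f x $ i \<le> f 1 $ i"
    using monotone_homogeneous_mono[OF f _ one_in_pos_cone, of x] by (simp add: less_eq_vec_def)
qed

lemma UNIV_in_max_actions:
  assumes f: "monotone_homogeneous f"
  shows "UNIV \<in> max_actions f i"
  unfolding max_actions_iff[OF f]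
proof (intro exI conjI ballI impI)
  show "0 < f 1 $ i"
    by (rule in_pos_coneD[OF monotone_homogeneous_in_cone[OF f one_in_pos_cone]])
  fix x :: "real ^ 'a"
  assume "x \<in> pos_cone" "\<forall>j\<in>UNIV. 1 \<le> x $ j"
  then show "f 1 $ i \<le> f x $ i"
    using monotone_homogeneous_mono[OF f one_in_pos_cone, of x] by (simp add: less_eq_vec_def)
qed

lemma min_actions_upward:
  assumes "monotone_homogeneous f" and "I \<in> min_actions f i" and "I \<subseteq> I'"
  shows "I' \<in> min_actions f i"
  using assms(2,3) unfolding min_actions_iff[OF assms(1)] by (meson subsetD)

lemma max_actions_upward:
  assumes "monotone_homogeneous f" and "J \<in> max_actions f i" and "J \<subseteq> J'"
  shows "J' \<in> max_actions f i"
  using assms(2,3) unfolding max_actions_iff[OF assms(1)] by (meson subsetD)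

text \<open>
  If \<open>I\<close> and \<open>J\<close> were disjoint, \<open>f\<close> would be bounded in coordinate \<open>i\<close> by the action of Min along
  the vectors equal to \<open>1\<close> on \<open>I\<close> and to \<open>t\<close> elsewhere, whereas the action of Max makes it grow
  at least linearly in \<open>t\<close>.
\<close>

lemma actions_meet:
  fixes f :: "real ^ 'n \<Rightarrow> real ^ 'n"
  assumes f: "monotone_homogeneous f"
    and I: "I \<in> min_actions f i" and J: "J \<in> max_actions f i"
  shows "I \<inter> J \<noteq> {}"
proof
  assume disj: "I \<inter> J = {}"
  obtain C where C: "\<And>x. x \<in> pos_cone \<Longrightarrow> \<forall>j\<in>I. x $ j \<le> 1 \<Longrightarrow> f x $ i \<le> C"
    using I by (auto simp: min_actions_iff[OF f])
  obtain c where c: "0 < c" "\<And>x. x \<in> pos_cone \<Longrightarrow> \<forall>j\<in>J. 1 \<le> x $ j \<Longrightarrow> c \<le> f x $ i"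
    using J by (auto simp: max_actions_iff[OF f])
  define t where "t = \<bar>C\<bar> / c + 1"
  have t: "0 < t"
    using c by (simp add: t_def add_nonneg_pos)
  define x :: "real ^ 'n" where "x = (\<chi> j. if j \<in> I then 1 else t)"
  have x: "x \<in> pos_cone"
    using t by (simp add: pos_cone_def x_def)
  have xt: "inverse t *\<^sub>R x \<in> pos_cone"
    using x t by (intro scaleR_in_pos_cone) auto
  have "c \<le> f (inverse t *\<^sub>R x) $ i"
    using disj t by (intro c(2) xt) (auto simp: x_def)
  also have "\<dots> = inverse t * f x $ i"
    using t by (simp add: monotone_homogeneous_scale[OF f x])
  finally have "c * t \<le> f x $ i"
    using t by (simp add: field_simps)
  also have "\<dots> \<le> C"
    by (intro C x) (auto simp: x_def)
  finally have "c * t \<le> C" .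
  moreover have "c * t = \<bar>C\<bar> + c"
    using c(1) by (simp add: t_def field_simps)
  ultimately show False
    using c(1) by linarith
qed

lemma stays_inI:
  fixes \<Delta> :: "'n::finite set"
  assumes i: "i \<in> \<Delta>"
    and step: "\<And>h s I J. s \<in> \<Delta> \<Longrightarrow> I \<in> set_pmf (\<sigma> h s) \<Longrightarrow> J \<in> set_pmf (\<tau> h s) \<Longrightarrow>
      I \<inter> J \<noteq> {} \<and> I \<inter> J \<subseteq> \<Delta>"
  shows "stays_in \<sigma> \<tau> i \<Delta>"
proof -
  have "\<forall>(h, s)\<in>set_pmf (play \<sigma> \<tau> i k). s \<in> \<Delta>" for k
  proof (induction k)
    case 0
    show ?case
      using i by simp
  next
    case (Suc k)
    have "t \<in> \<Delta>"
      if "(h, s) \<in> set_pmf (play \<sigma> \<tau> i k)" "I \<in> set_pmf (\<sigma> h s)" "J \<in> set_pmf (\<tau> h s)"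
        "t \<in> set_pmf (pmf_of_set (I \<inter> J))" for h s I J t
    proof -
      have "s \<in> \<Delta>"
        using Suc.IH that(1) by auto
      then have "I \<inter> J \<noteq> {}" "I \<inter> J \<subseteq> \<Delta>"
        using step that by blast+
      then show ?thesis
        using that(4) by auto
    qed
    then show ?case
      by (fastforce)
  qed
  then show ?thesis
    by (auto simp: stays_in_def AE_measure_pmf_iff)
qed

lemma stays_in_first_move:
  fixes \<Delta> :: "'n::finite set"
  assumes stay: "stays_in \<sigma> \<tau> i \<Delta>"
    and I: "I \<in> set_pmf (\<sigma> [] i)" and J: "J \<in> set_pmf (\<tau> [] i)" and meet: "I \<inter> J \<noteq> {}"
  shows "I \<inter> J \<subseteq> \<Delta>"
proof
  fix t
  assume "t \<in> I \<inter> J"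
  moreover have "set_pmf (pmf_of_set (I \<inter> J)) = I \<inter> J"
    using meet by simp
  ultimately have "([(i, I, J)], t) \<in> set_pmf (play \<sigma> \<tau> i (Suc 0))"
    using \<open>set_pmf (pmf_of_set (I \<inter> J)) = I \<inter> J\<close>
    by (auto simp: bind_return_pmf intro!: bexI[OF _ I] bexI[OF _ J])
  moreover have "AE (h, s) in measure_pmf (play \<sigma> \<tau> i (Suc 0)). s \<in> \<Delta>"
    using stay unfolding stays_in_def by (rule spec)
  ultimately show "t \<in> \<Delta>"
    unfolding AE_measure_pmf_iff by fast
qed

text \<open>
  To keep the state in \<open>\<Delta>\<close>, Min may play \<open>\<Delta>\<close> itself. Conversely, when Max
  plays the whole state space, the first action \<open>I\<close> of a strategy that stays in \<open>\<Delta>\<close> has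
  \<open>I \<subseteq> \<Delta>\<close>, so \<open>\<Delta>\<close> is an action too.
\<close>

lemma min_dominion_iff:
  fixes f :: "real ^ 'n \<Rightarrow> real ^ 'n"
  assumes f: "monotone_homogeneous f"
  shows "min_dominion f \<Delta> \<longleftrightarrow> \<Delta> \<noteq> {} \<and> (\<forall>i\<in>\<Delta>. \<Delta> \<in> min_actions f i)"
proof (intro iffI conjI ballI)
  assume dom: "min_dominion f \<Delta>"
  show "\<Delta> \<noteq> {}"
    using dom by (simp add: min_dominion_def)
  fix i
  assume "i \<in> \<Delta>"
  let ?\<tau> = "\<lambda>h s. return_pmf UNIV :: 'n set pmf"
  obtain \<sigma> where \<sigma>: "\<sigma> \<in> strategies (min_actions f)"
    and stay: "\<forall>\<tau>\<in>strategies (max_actions f). stays_in \<sigma> \<tau> i \<Delta>"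
    using dom \<open>i \<in> \<Delta>\<close> by (auto simp: min_dominion_def)
  have \<tau>: "?\<tau> \<in> strategies (max_actions f)"
    by (simp add: strategies_def UNIV_in_max_actions[OF f])
  obtain I where I: "I \<in> set_pmf (\<sigma> [] i)"
    using set_pmf_not_empty[of "\<sigma> [] i"] by blast
  then have act: "I \<in> min_actions f i"
    using \<sigma> by (auto simp: strategies_def)
  then have "I \<inter> UNIV \<noteq> {}"
    using actions_meet[OF f] UNIV_in_max_actions[OF f] by blast
  then have "I \<inter> UNIV \<subseteq> \<Delta>"
    using stays_in_first_move[OF bspec[OF stay \<tau>] I, of UNIV] by simp
  then show "\<Delta> \<in> min_actions f i"
    using min_actions_upward[OF f act] by simp
next
  assume R: "\<Delta> \<noteq> {} \<and> (\<forall>i\<in>\<Delta>. \<Delta> \<in> min_actions f i)"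
  let ?\<sigma> = "\<lambda>h s. return_pmf (if s \<in> \<Delta> then \<Delta> else UNIV)"
  have \<sigma>: "?\<sigma> \<in> strategies (min_actions f)"
    using R UNIV_in_min_actions[OF f] by (simp add: strategies_def)
  have "stays_in ?\<sigma> \<tau> i \<Delta>" if "i \<in> \<Delta>" "\<tau> \<in> strategies (max_actions f)" for i \<tau>
  proof (rule stays_inI[OF that(1)])
    fix h s I J
    assume *: "s \<in> \<Delta>" "I \<in> set_pmf (?\<sigma> h s)" "J \<in> set_pmf (\<tau> h s)"
    then have "I = \<Delta>" "J \<in> max_actions f s"
      using that(2) by (auto simp: strategies_def)
    then show "I \<inter> J \<noteq> {} \<and> I \<inter> J \<subseteq> \<Delta>"
      using R *(1) actions_meet[OF f] by blast
  qed
  then show "min_dominion f \<Delta>"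
    unfolding min_dominion_def using R \<sigma> by blast
qed

lemma max_dominion_iff:
  fixes f :: "real ^ 'n \<Rightarrow> real ^ 'n"
  assumes f: "monotone_homogeneous f"
  shows "max_dominion f \<Delta> \<longleftrightarrow> \<Delta> \<noteq> {} \<and> (\<forall>i\<in>\<Delta>. \<Delta> \<in> max_actions f i)"
proof (intro iffI conjI ballI)
  assume dom: "max_dominion f \<Delta>"
  show "\<Delta> \<noteq> {}"
    using dom by (simp add: max_dominion_def)
  fix i
  assume "i \<in> \<Delta>"
  let ?\<sigma> = "\<lambda>h s. return_pmf UNIV :: 'n set pmf"
  obtain \<tau> where \<tau>: "\<tau> \<in> strategies (max_actions f)"
    and stay: "\<forall>\<sigma>\<in>strategies (min_actions f). stays_in \<sigma> \<tau> i \<Delta>"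
    using dom \<open>i \<in> \<Delta>\<close> by (auto simp: max_dominion_def)
  have \<sigma>: "?\<sigma> \<in> strategies (min_actions f)"
    by (simp add: strategies_def UNIV_in_min_actions[OF f])
  obtain J where J: "J \<in> set_pmf (\<tau> [] i)"
    using set_pmf_not_empty[of "\<tau> [] i"] by blast
  then have act: "J \<in> max_actions f i"
    using \<tau> by (auto simp: strategies_def)
  then have "UNIV \<inter> J \<noteq> {}"
    using actions_meet[OF f] UNIV_in_min_actions[OF f] by blast
  then have "UNIV \<inter> J \<subseteq> \<Delta>"
    using stays_in_first_move[OF bspec[OF stay \<sigma>] _ J, of UNIV] by simp
  then show "\<Delta> \<in> max_actions f i"
    using max_actions_upward[OF f act] by simp
next
  assume R: "\<Delta> \<noteq> {} \<and> (\<forall>i\<in>\<Delta>. \<Delta> \<in> max_actions f i)"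
  let ?\<tau> = "\<lambda>h s. return_pmf (if s \<in> \<Delta> then \<Delta> else UNIV)"
  have \<tau>: "?\<tau> \<in> strategies (max_actions f)"
    using R UNIV_in_max_actions[OF f] by (simp add: strategies_def)
  have "stays_in \<sigma> ?\<tau> i \<Delta>" if "i \<in> \<Delta>" "\<sigma> \<in> strategies (min_actions f)" for i \<sigma>
  proof (rule stays_inI[OF that(1)])
    fix h s I J
    assume *: "s \<in> \<Delta>" "I \<in> set_pmf (\<sigma> h s)" "J \<in> set_pmf (?\<tau> h s)"
    then have "J = \<Delta>" "I \<in> min_actions f s"
      using that(2) by (auto simp: strategies_def)
    then show "I \<inter> J \<noteq> {} \<and> I \<inter> J \<subseteq> \<Delta>"
      using R *(1) actions_meet[OF f] by blast
  qed
  then show "max_dominion f \<Delta>"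
    unfolding max_dominion_def using R \<tau> by blast
qed

section \<open>Boundedness in the Hilbert metric and slice spaces\<close>

lemma pos_cone_comparable:
  fixes x y :: "real ^ 'n"
  assumes x: "x \<in> pos_cone" and y: "y \<in> pos_cone"
  shows "\<exists>a>0. \<exists>b>0. a *\<^sub>R y \<le> x \<and> x \<le> b *\<^sub>R y"
proof -
  obtain m M where m: "0 < m" "\<And>i. m \<le> x $ i" and M: "0 < M" "\<And>i. x $ i \<le> M"
    using pos_cone_bounds[OF x] by blast
  obtain n N where n: "0 < n" "\<And>i. n \<le> y $ i" and N: "0 < N" "\<And>i. y $ i \<le> N"
    using pos_cone_bounds[OF y] by blast
  have "m / N * y $ i \<le> x $ i" "x $ i \<le> M / n * y $ i" for i
  proof -
    have "m / N * y $ i \<le> m / N * N"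
      using m N by (intro mult_left_mono) auto
    then show "m / N * y $ i \<le> x $ i"
      using m(2)[of i] N(1) by simp
    have "M / n * n \<le> M / n * y $ i"
      using M n by (intro mult_left_mono) auto
    then show "x $ i \<le> M / n * y $ i"
      using M(2)[of i] n(1) by simp
  qed
  then show ?thesis
    using M m N n
    by (intro exI[of _ "m / N"] exI[of _ "M / n"] conjI) (auto simp: less_eq_vec_def)
qed

text \<open>
  For the forward direction fix a point \<open>y\<close> of \<open>S\<close>: a bound on the distance from \<open>y\<close> to \<open>x\<close> says
  that the entries of \<open>x\<close> are those of \<open>y\<close> up to a common scale and a bounded factor. Conversely,
  any two points are compared by comparing each of them with one of its own entries, which costs
  a factor \<open>R\<^sup>2\<close> on either side.
\<close>

lemma hilbert_bounded_iff:
  fixes S :: "(real ^ 'n) set"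
  assumes S: "S \<subseteq> pos_cone"
  shows "hilbert_bounded S \<longleftrightarrow> (\<exists>R. \<forall>x\<in>S. \<forall>i j. x $ i \<le> R * x $ j)"
proof -
  define H :: "real ^ 'n \<Rightarrow> real ^ 'n \<Rightarrow> real set"
    where "H x y = {b / a | a b. 0 < a \<and> 0 < b \<and> a *\<^sub>R x \<le> y \<and> y \<le> b *\<^sub>R x}" for x y
  have dist: "hilbert_dist x y = ln (Inf (H x y))" for x y
    by (simp add: hilbert_dist_def H_def)
  have ge_1: "1 \<le> r" if r: "r \<in> H x y" and x: "x \<in> pos_cone" for x y r
  proof -
    obtain a b where ab: "r = b / a" "0 < a" "0 < b" "a *\<^sub>R x \<le> y" "y \<le> b *\<^sub>R x"
      using r unfolding H_def by blast
    have "a * x $ undefined \<le> b * x $ undefined"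
      using order_trans[OF ab(4,5)] by (simp add: less_eq_vec_def)
    then have "a \<le> b"
      using in_pos_coneD[OF x] by (simp only: mult_le_cancel_right_pos)
    then show ?thesis
      using ab by simp
  qed
  have bdd: "bdd_below (H x y)" if "x \<in> pos_cone" for x y
    using ge_1[OF _ that] by (rule bdd_belowI)
  have nonempty: "H x y \<noteq> {}" if "x \<in> pos_cone" "y \<in> pos_cone" for x y
    using pos_cone_comparable[OF that(2,1)] unfolding H_def by blast
  have Inf_ge_1: "1 \<le> Inf (H x y)" if "x \<in> pos_cone" "y \<in> pos_cone" for x y
    using nonempty[OF that] ge_1[OF _ that(1)] by (rule cInf_greatest)
  show ?thesis
  proof
    assume "hilbert_bounded S"
    then obtain M where M: "\<And>x y. x \<in> S \<Longrightarrow> y \<in> S \<Longrightarrow> hilbert_dist x y \<le> M"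
      by (auto simp: hilbert_bounded_def)
    show "\<exists>R. \<forall>x\<in>S. \<forall>i j. x $ i \<le> R * x $ j"
    proof (cases "S = {}")
      case False
      then obtain y where y: "y \<in> S" "y \<in> pos_cone"
        using S by auto
      obtain n N where n: "0 < n" "\<And>i. n \<le> y $ i" and N: "0 < N" "\<And>i. y $ i \<le> N"
        using pos_cone_bounds[OF y(2)] by blast
      have "x $ i \<le> ((exp M + 1) * (N / n)) * x $ j" if x: "x \<in> S" for x i j
      proof -
        have xp: "x \<in> pos_cone"
          using x S by auto
        have "ln (Inf (H y x)) \<le> M"
          using M[OF y(1) x] by (simp add: dist)
        then have "Inf (H y x) \<le> exp M"
          using Inf_ge_1[OF y(2) xp] by (metis exp_le_cancel_iff exp_ln less_le_trans zero_less_one)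
        then have "Inf (H y x) < exp M + 1"
          by simp
        then obtain r where "r \<in> H y x" "r < exp M + 1"
          using cInf_lessD nonempty[OF y(2) xp] by blast
        then obtain a b where ab: "b / a < exp M + 1" "0 < a" "0 < b" "a *\<^sub>R y \<le> x" "x \<le> b *\<^sub>R y"
          by (auto simp: H_def)
        have "x $ i \<le> b * y $ i"
          using ab(5) by (simp add: less_eq_vec_def)
        also have "\<dots> \<le> b * N"
          using ab N by simp
        also have "\<dots> = (b / a) * (N / n) * (a * n)"
          using ab n by simp
        also have "\<dots> \<le> (exp M + 1) * (N / n) * (a * n)"
          using ab n N by (intro mult_right_mono) auto
        also have "\<dots> \<le> (exp M + 1) * (N / n) * x $ j"
        proof (intro mult_left_mono)
          have "a * n \<le> a * y $ j"
            using ab n by simp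
          also have "\<dots> \<le> x $ j"
            using ab(4) by (simp add: less_eq_vec_def)
          finally show "a * n \<le> x $ j" .
          show "0 \<le> (exp M + 1) * (N / n)"
            using N n by (simp add: add_nonneg_nonneg)
        qed
        finally show ?thesis .
      qed
      then show ?thesis
        by blast
    qed simp
  next
    assume "\<exists>R. \<forall>x\<in>S. \<forall>i j. x $ i \<le> R * x $ j"
    then obtain R where R: "\<And>x i j. x \<in> S \<Longrightarrow> x $ i \<le> R * x $ j"
      by blast
    have "hilbert_dist x y \<le> ln (R ^ 4)" if xy: "x \<in> S" "y \<in> S" for x y
    proof -
      let ?k = "undefined :: 'n"
      have p: "x \<in> pos_cone" "y \<in> pos_cone"
        using S xy by auto
      note pos = in_pos_coneD[OF p(1)] in_pos_coneD[OF p(2)]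
      have "1 * x $ ?k \<le> R * x $ ?k"
        using R[OF xy(1)] by simp
      then have R1: "1 \<le> R"
        using pos(1)[of ?k] by (simp only: mult_le_cancel_right_pos)
      define a where "a = y $ ?k / (R\<^sup>2 * x $ ?k)"
      define b where "b = R\<^sup>2 * y $ ?k / x $ ?k"
      have ab: "0 < a" "0 < b"
        using R1 pos by (simp_all add: a_def b_def)
      have "a * x $ i \<le> y $ i" "y $ i \<le> b * x $ i" for i
      proof -
        have "x $ i * y $ ?k \<le> (R * x $ ?k) * (R * y $ i)"
          using R[OF xy(1)] R[OF xy(2)] pos R1 by (intro mult_mono) (auto intro: less_imp_le)
        then show "a * x $ i \<le> y $ i"
          using pos[of ?k] R1 by (simp add: a_def field_simps power2_eq_square)
        have "y $ i * x $ ?k \<le> (R * y $ ?k) * (R * x $ i)"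
          using R[OF xy(1)] R[OF xy(2)] pos R1 by (intro mult_mono) (auto intro: less_imp_le)
        then show "y $ i \<le> b * x $ i"
          using pos[of ?k] R1 by (simp add: b_def field_simps power2_eq_square)
      qed
      then have "b / a \<in> H x y"
        using ab unfolding H_def by (auto simp: less_eq_vec_def)
      moreover have "b / a = R ^ 4"
        using pos[of ?k] R1 by (simp add: a_def b_def field_simps power2_eq_square power4_eq_xxxx)
      ultimately have "Inf (H x y) \<le> R ^ 4"
        using cInf_lower bdd p(1) by metis
      then show ?thesis
        using Inf_ge_1[OF p] by (simp add: dist ln_mono)
    qed
    then show "hilbert_bounded S"
      unfolding hilbert_bounded_def by blast
  qed
qed

definition bounded_slices :: "(real ^ 'n \<Rightarrow> real ^ 'n) \<Rightarrow> bool" where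
  "bounded_slices f \<longleftrightarrow>
     (\<forall>a>0. \<forall>b>0. \<exists>R. \<forall>x\<in>slice_space f a b. \<forall>i j. x $ i \<le> R * x $ j)"

lemma bounded_slices_iff:
  "bounded_slices f \<longleftrightarrow> (\<forall>a>0. \<forall>b>0. hilbert_bounded (slice_space f a b))"
proof -
  have "slice_space f a b \<subseteq> pos_cone" for a b
    by (auto simp: slice_space_def)
  then show ?thesis
    by (simp add: bounded_slices_def hilbert_bounded_iff)
qed

text \<open>
  If the slice space is unbounded, take points \<open>x n\<close> of it whose extreme entries \<open>Mx n\<close>, \<open>mx n\<close>
  have ratio tending to \<open>\<infinity>\<close>. Along a subsequence the entries of \<open>x n / Mx n\<close> and \<open>mx n / x n\<close>
  converge. The coordinates that stay comparable to the smallest entry form a dominion of Min,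
  those that stay comparable to the largest one a dominion of Max: rescaled, the points \<open>x n\<close>
  tend to \<open>\<infinity>\<close> off the first set and to \<open>0\<close> off the second one, and the
  slice inequalities bound \<open>f\<close> at them.
\<close>

lemma unbounded_slice_gives_disjoint_dominions:
  fixes f :: "real ^ 'n \<Rightarrow> real ^ 'n"
  assumes f: "monotone_homogeneous f" and a: "0 < a" and b: "0 < b"
    and unbounded: "\<nexists>R. \<forall>x\<in>slice_space f a b. \<forall>i j. x $ i \<le> R * x $ j"
  shows "\<exists>K J. min_dominion f K \<and> max_dominion f J \<and> K \<inter> J = {}"
proof -
  have "\<forall>n. \<exists>x i j. x \<in> slice_space f a b \<and> real (Suc n) * x $ j < x $ i"
    using unbounded by (meson not_le)
  then obtain x p q where x: "\<And>n. x n \<in> slice_space f a b"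
    and ratio: "\<And>n. real (Suc n) * x n $ q n < x n $ p n"
    by metis
  have "\<forall>n. \<exists>i. \<forall>j. x n $ j \<le> x n $ i" "\<forall>n. \<exists>i. \<forall>j. x n $ i \<le> x n $ j"
    using max_entry min_entry by blast+
  then obtain P Q where P: "\<And>n j. x n $ j \<le> x n $ P n" and Q: "\<And>n j. x n $ Q n \<le> x n $ j"
    by metis
  define Mx where "Mx n = x n $ P n" for n
  define mx where "mx n = x n $ Q n" for n
  have cone: "x n \<in> pos_cone" and lower: "a *\<^sub>R x n \<le> f (x n)" and upper: "f (x n) \<le> b *\<^sub>R x n" for n
    using x[of n] by (auto simp: slice_space_def)
  note pos = in_pos_coneD[OF cone]
  have le_Mx: "x n $ i \<le> Mx n" and mx_le: "mx n \<le> x n $ i" for n i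
    unfolding Mx_def mx_def by (rule P, rule Q)
  have Mx_pos: "0 < Mx n" and mx_pos: "0 < mx n" for n
    unfolding Mx_def mx_def by (rule pos)+
  define z where "z n = inverse (Mx n) *\<^sub>R x n" for n
  define v where "v n = inverse (mx n) *\<^sub>R x n" for n
  define w where "w n = (\<chi> i. mx n / x n $ i)" for n
  have z_cone: "z n \<in> pos_cone" and v_cone: "v n \<in> pos_cone" for n
    unfolding z_def v_def using cone Mx_pos mx_pos by (auto intro: scaleR_in_pos_cone)
  have z_box: "z n \<in> cbox 0 1" for n
    using pos[of n] le_Mx[of n] Mx_pos[of n]
    by (auto simp: mem_box_cart z_def field_simps less_imp_le)
  have w_box: "w n \<in> cbox 0 1" for n
    using pos[of n] mx_le[of n] mx_pos[of n]
    by (auto simp: mem_box_cart w_def field_simps less_imp_le)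
  have "compact (cbox 0 1 \<times> cbox 0 1 :: ((real ^ 'n) \<times> (real ^ 'n)) set)"
    by (intro compact_Times compact_cbox)
  then obtain l s where s: "strict_mono s" and l: "((\<lambda>n. (z n, w n)) \<circ> s) \<longlonglongrightarrow> l"
    unfolding compact_def using z_box w_box by (metis (no_types, lifting) mem_Sigma_iff)
  define \<zeta> where "\<zeta> = fst l"
  define \<omega> where "\<omega> = snd l"
  have z_lim: "(\<lambda>n. z (s n) $ i) \<longlonglongrightarrow> \<zeta> $ i" for i
    using tendsto_vec_nth[OF tendsto_fst[OF l]] by (simp add: \<zeta>_def o_def)
  have w_lim: "(\<lambda>n. w (s n) $ i) \<longlonglongrightarrow> \<omega> $ i" for i
    using tendsto_vec_nth[OF tendsto_snd[OF l]] by (simp add: \<omega>_def o_def)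
  have \<zeta>_nonneg: "0 \<le> \<zeta> $ i" for i
    using z_box by (intro LIMSEQ_le_const[OF z_lim]) (auto simp: mem_box_cart)
  have \<omega>_nonneg: "0 \<le> \<omega> $ i" for i
    using w_box by (intro LIMSEQ_le_const[OF w_lim]) (auto simp: mem_box_cart)
  define J where "J = {i. 0 < \<zeta> $ i}"
  define K where "K = {i. 0 < \<omega> $ i}"

  \<comment> \<open>The largest entry of each \<open>z n\<close> is \<open>1\<close>, but its index varies, whereas the sum of the
    entries is at least \<open>1\<close> and passes to the limit.\<close>
  have "1 \<le> (\<Sum>i\<in>UNIV. z n $ i)" for n
  proof -
    have "z n $ P n \<le> (\<Sum>i\<in>UNIV. z n $ i)"
      using in_pos_coneD[OF z_cone] by (intro member_le_sum) (auto intro: less_imp_le)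
    then show ?thesis
      using Mx_pos[of n] by (simp add: z_def Mx_def)
  qed
  then have "1 \<le> (\<Sum>i\<in>UNIV. \<zeta> $ i)"
    by (intro LIMSEQ_le_const[OF tendsto_sum[OF z_lim]]) auto
  then have "J \<noteq> {}"
    using sum_nonpos[of UNIV "($) \<zeta>"] by (force simp: J_def not_less)
  have "1 \<le> (\<Sum>i\<in>UNIV. w n $ i)" for n
  proof -
    have "w n $ Q n \<le> (\<Sum>i\<in>UNIV. w n $ i)"
      using w_box[of n] by (intro member_le_sum) (auto simp: mem_box_cart)
    then show ?thesis
      using mx_pos[of n] by (simp add: w_def mx_def)
  qed
  then have "1 \<le> (\<Sum>i\<in>UNIV. \<omega> $ i)"
    by (intro LIMSEQ_le_const[OF tendsto_sum[OF w_lim]]) auto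
  then have "K \<noteq> {}"
    using sum_nonpos[of UNIV "($) \<omega>"] by (force simp: K_def not_less)

  have "K \<inter> J = {}"
  proof -
    have "\<zeta> $ i * \<omega> $ i \<le> 0" for i
    proof (rule LIMSEQ_le[OF tendsto_mult[OF z_lim w_lim]])
      show "(\<lambda>n. inverse (real (Suc n))) \<longlonglongrightarrow> 0"
        by (rule LIMSEQ_inverse_real_of_nat)
      have "z (s n) $ i * w (s n) $ i \<le> inverse (real (Suc n))" for n
      proof -
        have "real (Suc n) * mx (s n) \<le> real (Suc (s n)) * x (s n) $ q (s n)"
          using seq_suble[OF s, of n] mx_le mx_pos[of "s n"] by (intro mult_mono) auto
        also have "\<dots> \<le> Mx (s n)"
          using ratio[of "s n"] le_Mx[of "s n" "p (s n)"] by simp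
        finally have "mx (s n) / Mx (s n) \<le> inverse (real (Suc n))"
          using Mx_pos[of "s n"] by (simp add: field_simps)
        then show ?thesis
          using pos[of "s n" i] by (simp add: z_def w_def field_simps)
      qed
      then show "\<exists>N. \<forall>n\<ge>N. z (s n) $ i * w (s n) $ i \<le> inverse (real (Suc n))"
        by blast
    qed
    then have "\<not> 0 < \<zeta> $ i * \<omega> $ i" for i
      by (simp add: not_less)
    then show ?thesis
      unfolding J_def K_def using mult_pos_pos by blast
  qed

  have "J \<in> max_actions f i" if "i \<in> J" for i
    unfolding max_actions_iff[OF f]
  proof (intro exI[of _ "a * \<zeta> $ i"] conjI ballI impI)
    show "0 < a * \<zeta> $ i"
      using a that by (simp add: J_def)
    fix y :: "real ^ 'n"
    assume y: "y \<in> pos_cone" "\<forall>j\<in>J. 1 \<le> y $ j"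
    have ev: "eventually (\<lambda>n. \<forall>j. z (s n) $ j \<le> y $ j) sequentially"
    proof (intro eventually_all_finite)
      fix j
      show "eventually (\<lambda>n. z (s n) $ j \<le> y $ j) sequentially"
      proof (cases "j \<in> J")
        case True
        then have "z n $ j \<le> y $ j" for n
          using y(2) z_box[of n] by (auto simp: mem_box_cart intro: order_trans)
        then show ?thesis
          by simp
      next
        case False
        then have "\<zeta> $ j < y $ j"
          using \<zeta>_nonneg[of j] in_pos_coneD[OF y(1), of j] by (simp add: J_def)
        then have "eventually (\<lambda>n. z (s n) $ j < y $ j) sequentially"
          by (rule order_tendstoD(2)[OF z_lim])
        then show ?thesis
          by eventually_elim simp
      qed
    qed
    show "a * \<zeta> $ i \<le> f y $ i"
    proof (rule tendsto_upperbound[OF tendsto_mult_left[OF z_lim]])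
      show "eventually (\<lambda>n. a * z (s n) $ i \<le> f y $ i) sequentially"
        using ev
      proof eventually_elim
        case (elim n)
        have "a * z (s n) $ i = inverse (Mx (s n)) * (a * x (s n) $ i)"
          by (simp add: z_def)
        also have "\<dots> \<le> inverse (Mx (s n)) * f (x (s n)) $ i"
          using lower[of "s n"] Mx_pos[of "s n"] by (intro mult_left_mono) (auto simp: less_eq_vec_def)
        also have "\<dots> = f (z (s n)) $ i"
          using Mx_pos[of "s n"] by (simp add: z_def monotone_homogeneous_scale[OF f cone])
        also have "\<dots> \<le> f y $ i"
          using monotone_homogeneous_mono[OF f z_cone y(1)] elim by (simp add: less_eq_vec_def)
        finally show ?case .
      qed
    qed simp
  qed
  then have "max_dominion f J"
    using \<open>J \<noteq> {}\<close> by (simp add: max_dominion_iff[OF f])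

  have "K \<in> min_actions f i" if "i \<in> K" for i
    unfolding min_actions_iff[OF f]
  proof (intro exI[of _ "b / \<omega> $ i"] ballI impI)
    fix y :: "real ^ 'n"
    assume y: "y \<in> pos_cone" "\<forall>j\<in>K. y $ j \<le> 1"
    note y_pos = in_pos_coneD[OF y(1)]
    have v_w: "v n $ j = inverse (w n $ j)" and w_pos: "0 < w n $ j" for n j
      using pos[of n j] mx_pos[of n] by (simp_all add: v_def w_def field_simps)
    have ev: "eventually (\<lambda>n. \<forall>j. y $ j \<le> v (s n) $ j) sequentially"
    proof (intro eventually_all_finite)
      fix j
      show "eventually (\<lambda>n. y $ j \<le> v (s n) $ j) sequentially"
      proof (cases "j \<in> K")
        case True
        have "1 \<le> v n $ j" for n
          using mx_le[of n j] mx_pos[of n] by (simp add: v_def field_simps)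
        with True y(2) have "y $ j \<le> v n $ j" for n
          by (meson order_trans)
        then show ?thesis
          by simp
      next
        case False
        then have "\<omega> $ j < inverse (y $ j)"
          using \<omega>_nonneg[of j] y_pos[of j] by (simp add: K_def)
        then have "eventually (\<lambda>n. w (s n) $ j < inverse (y $ j)) sequentially"
          by (rule order_tendstoD(2)[OF w_lim])
        then show ?thesis
        proof eventually_elim
          case (elim n)
          then show ?case
            using y_pos[of j] w_pos[of "s n" j] by (simp add: v_w field_simps)
        qed
      qed
    qed
    have "(\<lambda>n. b / w (s n) $ i) \<longlonglongrightarrow> b / \<omega> $ i"
      using that by (intro tendsto_divide tendsto_const w_lim) (simp add: K_def)
    then show "f y $ i \<le> b / \<omega> $ i"
    proof (rule tendsto_lowerbound)
      show "eventually (\<lambda>n. f y $ i \<le> b / w (s n) $ i) sequentially"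
        using ev
      proof eventually_elim
        case (elim n)
        have "f y $ i \<le> f (v (s n)) $ i"
          using monotone_homogeneous_mono[OF f y(1) v_cone] elim by (simp add: less_eq_vec_def)
        also have "\<dots> = inverse (mx (s n)) * f (x (s n)) $ i"
          using mx_pos[of "s n"] by (simp add: v_def monotone_homogeneous_scale[OF f cone])
        also have "\<dots> \<le> inverse (mx (s n)) * (b * x (s n) $ i)"
          using upper[of "s n"] mx_pos[of "s n"] by (intro mult_left_mono) (auto simp: less_eq_vec_def)
        also have "\<dots> = b / w (s n) $ i"
          by (simp add: w_def field_simps)
        finally show ?case .
      qed
    qed simp
  qed
  then have "min_dominion f K"
    using \<open>K \<noteq> {}\<close> by (simp add: min_dominion_iff[OF f])
  with \<open>max_dominion f J\<close> \<open>K \<inter> J = {}\<close> show ?thesis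
    by blast
qed

section \<open>Uniform perturbations\<close>

text \<open>
  The bounds of a nonempty slice space cannot be arbitrary: compare \<open>x\<close> with the constant vectors whose value is its largest, respectively smallest,
  entry, and look at the coordinate where this entry is attained.
\<close>

lemma slice_space_bounds:
  fixes f :: "real ^ 'n \<Rightarrow> real ^ 'n"
  assumes f: "monotone_homogeneous f" and x: "x \<in> slice_space f a b"
    and m: "\<And>i. m \<le> f 1 $ i" and M: "\<And>i. f 1 $ i \<le> M"
  shows "a \<le> M" and "m \<le> b"
proof -
  have cone: "x \<in> pos_cone" and lower: "a *\<^sub>R x \<le> f x" and upper: "f x \<le> b *\<^sub>R x"
    using x by (auto simp: slice_space_def)
  note pos = in_pos_coneD[OF cone]
  obtain i where i: "\<And>j. x $ j \<le> x $ i"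
    using max_entry by blast
  then have "f x \<le> x $ i *\<^sub>R f 1"
    using pos by (intro monotone_homogeneous_scaled_mono(1)[OF f cone one_in_pos_cone])
      (auto simp: less_eq_vec_def)
  then have "a * x $ i \<le> x $ i * f 1 $ i"
    using lower by (auto simp: less_eq_vec_def intro: order_trans)
  also have "\<dots> \<le> x $ i * M"
    using pos[of i] M by (intro mult_left_mono) auto
  finally show "a \<le> M"
    using pos[of i] by (simp add: mult.commute)
  obtain i where i: "\<And>j. x $ i \<le> x $ j"
    using min_entry by blast
  then have "x $ i *\<^sub>R f 1 \<le> f x"
    using pos by (intro monotone_homogeneous_scaled_mono(2)[OF f one_in_pos_cone cone])
      (auto simp: less_eq_vec_def)
  then have "x $ i * f 1 $ i \<le> b * x $ i"
    using upper by (auto simp: less_eq_vec_def intro: order_trans)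
  moreover have "x $ i * m \<le> x $ i * f 1 $ i"
    using pos[of i] m by (intro mult_left_mono) auto
  ultimately have "x $ i * m \<le> x $ i * b"
    by (simp add: mult.commute)
  then show "m \<le> b"
    using pos[of i] by simp
qed

text \<open>
  In the definition of a uniform perturbation only the ratio of the two factors is bounded, so
  a slice space of \<open>g\<close> is a priori covered by slice spaces of \<open>f\<close> with bounds \<open>a'\<close>, \<open>b'\<close> that
  may both be arbitrarily small or large, only \<open>b' / a'\<close> being controlled. But a nonempty slice
  space has \<open>a'\<close> bounded above and \<open>b'\<close> bounded below, so that a single slice space of \<open>f\<close>
  suffices.
\<close>

lemma bounded_slices_perturbation:
  fixes f g :: "real ^ 'n \<Rightarrow> real ^ 'n"
  assumes f: "monotone_homogeneous f" and pert: "uniform_perturbation f g"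
    and bounded: "bounded_slices f"
  shows "bounded_slices g"
  unfolding bounded_slices_def
proof (intro allI impI)
  fix a b :: real
  assume ab: "0 < a" "0 < b"
  obtain c where c: "1 \<le> c" and pert_c: "\<And>x. x \<in> pos_cone \<Longrightarrow>
      \<exists>\<alpha>>0. \<exists>\<beta>>0. \<beta> / \<alpha> \<le> c \<and> \<alpha> *\<^sub>R f x \<le> g x \<and> g x \<le> \<beta> *\<^sub>R f x"
    using pert unfolding uniform_perturbation_def by blast
  have f1: "f 1 \<in> pos_cone"
    by (rule monotone_homogeneous_in_cone[OF f one_in_pos_cone])
  obtain m M where m: "0 < m" "\<And>i. m \<le> f 1 $ i" and M: "0 < M" "\<And>i. f 1 $ i \<le> M"
    using pos_cone_bounds[OF f1] by blast
  define a' where "a' = a * m / (c * b)"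
  define b' where "b' = c * b * M / a"
  have "0 < a'" "0 < b'"
    using ab m M c by (simp_all add: a'_def b'_def)
  then obtain R where R: "\<forall>x\<in>slice_space f a' b'. \<forall>i j. x $ i \<le> R * x $ j"
    using bounded unfolding bounded_slices_def by blast
  have "x \<in> slice_space f a' b'" if "x \<in> slice_space g a b" for x
  proof -
    have x: "x \<in> pos_cone" "a *\<^sub>R x \<le> g x" "g x \<le> b *\<^sub>R x"
      using that by (auto simp: slice_space_def)
    note pos = in_pos_coneD[OF x(1)]
    obtain \<alpha> \<beta> where \<alpha>: "0 < \<alpha>" "\<alpha> *\<^sub>R f x \<le> g x" and \<beta>: "0 < \<beta>" "g x \<le> \<beta> *\<^sub>R f x"
      and ratio: "\<beta> / \<alpha> \<le> c"
      using pert_c[OF x(1)] by blast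
    have lower: "a / \<beta> * x $ i \<le> f x $ i" for i
    proof -
      have "a * x $ i \<le> \<beta> * f x $ i"
        using x(2) \<beta>(2) by (auto simp: less_eq_vec_def intro: order_trans)
      then show ?thesis
        using \<beta>(1) by (simp add: field_simps)
    qed
    have upper: "f x $ i \<le> b / \<alpha> * x $ i" for i
    proof -
      have "\<alpha> * f x $ i \<le> b * x $ i"
        using x(3) \<alpha>(2) by (auto simp: less_eq_vec_def intro: order_trans)
      then show ?thesis
        using \<alpha>(1) by (simp add: field_simps)
    qed
    have "x \<in> slice_space f (a / \<beta>) (b / \<alpha>)"
      using x(1) lower upper by (simp add: slice_space_def less_eq_vec_def)
    then have "a / \<beta> \<le> M" and "m \<le> b / \<alpha>"
      using slice_space_bounds[OF f _ m(2) M(2)] by blast+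
    then have 1: "a \<le> M * \<beta>" "m * \<alpha> \<le> b" "\<beta> \<le> c * \<alpha>"
      using \<alpha>(1) \<beta>(1) ratio by (simp_all add: field_simps)
    have "a' \<le> a / \<beta>"
    proof -
      have "m * \<beta> \<le> m * (c * \<alpha>)"
        using 1 m by simp
      also have "\<dots> = c * (m * \<alpha>)"
        by simp
      also have "\<dots> \<le> c * b"
        using 1 c by simp
      finally have "a * (m * \<beta>) \<le> a * (c * b)"
        using ab by simp
      then show ?thesis
        using \<beta>(1) c ab by (simp add: a'_def field_simps)
    qed
    moreover have "b / \<alpha> \<le> b'"
    proof -
      have "a \<le> M * (c * \<alpha>)"
        using 1 M(1) by (meson mult_left_mono less_imp_le order_trans)
      then have "b * a \<le> b * (M * (c * \<alpha>))"
        using ab by simp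
      then show ?thesis
        using \<alpha>(1) c ab by (simp add: b'_def field_simps)
    qed
    ultimately have "a' * x $ i \<le> f x $ i" "f x $ i \<le> b' * x $ i" for i
      using lower[of i] upper[of i] pos[of i]
      by (meson mult_right_mono less_imp_le order_trans)+
    then show ?thesis
      using x(1) by (simp add: slice_space_def less_eq_vec_def)
  qed
  with R show "\<exists>R. \<forall>x\<in>slice_space g a b. \<forall>i j. x $ i \<le> R * x $ j"
    by blast
qed

section \<open>Eigenvectors and growth rates\<close>

text \<open>
  The points \<open>x = r ^ Suc k\<close> solve the discounted equation \<open>f x = x powr (1 + 1 / Suc k)\<close>. The
  map in the proof is the corresponding fixed-point operator; since \<open>f\<close> is monotone, it maps the
  box of constant bounds \<open>m\<close>, \<open>M\<close> to itself, and Brouwer's theorem applies.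
\<close>

lemma discounted_eigenvector_exists:
  fixes f :: "real ^ 'n \<Rightarrow> real ^ 'n"
  assumes f: "monotone_homogeneous f"
    and m: "0 < m" "\<And>i. m \<le> f 1 $ i" and M: "\<And>i. f 1 $ i \<le> M"
  shows "\<exists>r. \<forall>i. m \<le> r $ i \<and> r $ i \<le> M \<and> f (\<chi> j. r $ j ^ Suc k) $ i = r $ i * r $ i ^ Suc k"
proof -
  let ?B = "cbox (\<chi> i. m) (\<chi> i. M) :: (real ^ 'n) set"
  define e where "e r = (\<chi> j. r $ j ^ Suc k)" for r :: "real ^ 'n"
  define G where "G r = (\<chi> i. root (Suc (Suc k)) (f (e r) $ i))" for r
  have M_pos: "0 < M"
    using m M by (meson less_le_trans)
  have box: "m \<le> r $ i \<and> r $ i \<le> M" if "r \<in> ?B" for r i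
    using that by (simp add: mem_box_cart)
  have e_cone: "e r \<in> pos_cone" if "r \<in> ?B" for r
  proof -
    have "0 < r $ i" for i
      using box[OF that, of i] m(1) by linarith
    then show ?thesis
      by (simp add: pos_cone_def e_def)
  qed
  have f_e: "m ^ Suc (Suc k) \<le> f (e r) $ i \<and> f (e r) $ i \<le> M ^ Suc (Suc k)" if r: "r \<in> ?B" for r i
  proof -
    have "m ^ Suc k \<le> r $ j ^ Suc k \<and> r $ j ^ Suc k \<le> M ^ Suc k" for j
      using box[OF r, of j] m(1) by (intro conjI power_mono) linarith+
    then have "m ^ Suc k *\<^sub>R 1 \<le> e r" "e r \<le> M ^ Suc k *\<^sub>R 1"
      by (simp_all add: less_eq_vec_def e_def)
    then have "m ^ Suc k *\<^sub>R f 1 \<le> f (e r)" "f (e r) \<le> M ^ Suc k *\<^sub>R f 1"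
      using monotone_homogeneous_scaled_mono(1)[OF f e_cone[OF r] one_in_pos_cone]
        monotone_homogeneous_scaled_mono(2)[OF f one_in_pos_cone e_cone[OF r]] m(1) M_pos
      by (meson zero_less_power)+
    then have "m ^ Suc k * f 1 $ i \<le> f (e r) $ i" "f (e r) $ i \<le> M ^ Suc k * f 1 $ i"
      by (simp_all add: less_eq_vec_def)
    moreover have "m ^ Suc k * m \<le> m ^ Suc k * f 1 $ i" "M ^ Suc k * f 1 $ i \<le> M ^ Suc k * M"
      using m M M_pos by (intro mult_left_mono zero_le_power; simp add: less_imp_le)+
    ultimately show ?thesis
      by (simp only: power_Suc2[of _ "Suc k"]) linarith
  qed
  have "G \<in> ?B \<rightarrow> ?B"
  proof
    fix r
    assume r: "r \<in> ?B"
    have "root (Suc (Suc k)) (m ^ Suc (Suc k)) \<le> G r $ i"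
      "G r $ i \<le> root (Suc (Suc k)) (M ^ Suc (Suc k))" for i
      using f_e[OF r, of i] unfolding G_def by (simp_all only: vec_lambda_beta real_root_le_mono zero_less_Suc)
    then show "G r \<in> ?B"
      using m(1) M_pos by (simp only: mem_box_cart real_root_power_cancel less_imp_le zero_less_Suc) simp
  qed
  moreover have "continuous_on ?B G"
  proof -
    have "continuous_on ?B e"
      unfolding e_def by (intro continuous_intros)
    then have "continuous_on ?B (\<lambda>r. f (e r))"
      by (rule continuous_on_compose2[OF monotone_homogeneous_continuous_on[OF f]])
        (use e_cone in blast)
    then show ?thesis
      unfolding G_def by (intro continuous_intros)
  qed
  moreover have "?B \<noteq> {}"
    using order_trans[OF m(2) M] by (auto simp: interval_ne_empty_cart)
  ultimately obtain r where r: "r \<in> ?B" "G r = r"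
    using brouwer[of ?B G] by (auto intro: compact_cbox convex_box)
  have "f (e r) $ i = r $ i * r $ i ^ Suc k" for i
  proof -
    have "r $ i ^ Suc (Suc k) = root (Suc (Suc k)) (f (e r) $ i) ^ Suc (Suc k)"
      using r(2) by (metis G_def vec_lambda_beta)
    also have "\<dots> = f (e r) $ i"
      using in_pos_coneD[OF monotone_homogeneous_in_cone[OF f e_cone[OF r(1)]], of i]
      by (intro real_root_pow_pos2) auto
    finally show ?thesis
      by simp
  qed
  then show ?thesis
    using box[OF r(1)] unfolding e_def by blast
qed

text \<open>
  The discounted solutions \<open>x k = r k ^ Suc k\<close> satisfy \<open>f (x k) = r k * x k\<close> with the factors
  \<open>r k\<close> in a fixed compact interval, so they lie in one slice space, and the ratios of
  their entries are at most a constant \<open>R\<close>. The ratios of the entries of \<open>r k\<close> are then at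
  most the root of \<open>R\<close> of order \<open>Suc k\<close>, which tends to \<open>1\<close>. Hence any limit of the normalised
  solutions is an eigenvector.
\<close>

lemma bounded_slices_imp_eigenvector:
  fixes f :: "real ^ 'n \<Rightarrow> real ^ 'n"
  assumes f: "monotone_homogeneous f" and bounded: "bounded_slices f"
  shows "has_eigenvector f"
proof -
  have f1: "f 1 \<in> pos_cone"
    by (rule monotone_homogeneous_in_cone[OF f one_in_pos_cone])
  obtain m M where m: "0 < m" "\<And>i. m \<le> f 1 $ i" and M: "0 < M" "\<And>i. f 1 $ i \<le> M"
    using pos_cone_bounds[OF f1] by blast
  have "\<forall>k. \<exists>r. \<forall>i. m \<le> r $ i \<and> r $ i \<le> M \<and> f (\<chi> j. r $ j ^ Suc k) $ i = r $ i * r $ i ^ Suc k"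
    using discounted_eigenvector_exists[OF f m M(2)] by blast
  then obtain r where r: "\<And>k i. m \<le> r k $ i" "\<And>k i. r k $ i \<le> M"
    and f_r: "\<And>k i. f (\<chi> j. r k $ j ^ Suc k) $ i = r k $ i * r k $ i ^ Suc k"
    by metis
  have r_pos: "0 < r k $ i" for k i
    using r(1)[of k i] m(1) by simp
  define x where "x k = (\<chi> j. r k $ j ^ Suc k)" for k
  have x_nth: "x k $ i = r k $ i ^ Suc k" for k i
    by (simp add: x_def)
  have f_x: "f (x k) $ i = r k $ i * x k $ i" for k i
    using f_r[of k i] by (simp add: x_def)
  have x_pos: "0 < x k $ i" for k i
    unfolding x_nth by (rule zero_less_power[OF r_pos])
  then have x_cone: "x k \<in> pos_cone" for k
    by (simp add: pos_cone_def)
  have slice: "x k \<in> slice_space f m M" for k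
    using x_cone[of k] r[of k] x_pos[of k]
    by (simp add: slice_space_def less_eq_vec_def f_x mult_right_mono less_imp_le)
  obtain R where R: "\<forall>x\<in>slice_space f m M. \<forall>i j. x $ i \<le> R * x $ j"
    using bounded m(1) M(1) unfolding bounded_slices_def by blast
  have x_R: "x k $ i \<le> R * x k $ j" for k i j
    using R slice by blast
  fix i0 :: 'n
  have "1 * x 0 $ i0 \<le> R * x 0 $ i0"
    using x_R by simp
  then have R1: "1 \<le> R"
    using x_pos[of 0 i0] by (simp only: mult_le_cancel_right_pos)
  have r_R: "r k $ i \<le> root (Suc k) R * r k $ j" for k i j
  proof -
    have "root (Suc k) (x k $ i) \<le> root (Suc k) (R * x k $ j)"
      by (intro real_root_le_mono x_R) simp
    then show ?thesis
      unfolding real_root_mult x_nth using r_pos[of k]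
      by (simp only: real_root_power_cancel less_imp_le zero_less_Suc)
  qed
  define y where "y k = inverse (x k $ i0) *\<^sub>R x k" for k
  have y_cone: "y k \<in> pos_cone" for k
    unfolding y_def using x_pos x_cone by (intro scaleR_in_pos_cone) auto
  have y_bounds: "1 / R \<le> y k $ i" "y k $ i \<le> R" for k i
    using x_R[of k i i0] x_R[of k i0 i] x_pos[of k] R1 by (simp_all add: y_def field_simps)
  have f_y: "f (y k) $ i = r k $ i * y k $ i" for k i
    using x_pos[of k i0] by (simp add: y_def monotone_homogeneous_scale[OF f x_cone] f_x)
  have "(r k, y k) \<in> cbox (\<chi> i. m) (\<chi> i. M) \<times> cbox (\<chi> i. 1 / R) (\<chi> i. R)" for k
    using r y_bounds by (simp add: mem_box_cart)
  moreover have "compact (cbox (\<chi> i. m) (\<chi> i. M) \<times> cbox (\<chi> i. 1 / R) (\<chi> i. R) :: ((real ^ 'n) \<times> (real ^ 'n)) set)"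
    by (intro compact_Times compact_cbox)
  ultimately obtain l s where s: "strict_mono s" and l: "((\<lambda>k. (r k, y k)) \<circ> s) \<longlonglongrightarrow> l"
    unfolding compact_def by (metis (no_types, lifting))
  define \<rho> where "\<rho> = fst l"
  define u where "u = snd l"
  have r_lim: "(\<lambda>k. r (s k) $ i) \<longlonglongrightarrow> \<rho> $ i" for i
    using tendsto_vec_nth[OF tendsto_fst[OF l]] by (simp add: \<rho>_def o_def)
  have y_lim: "(\<lambda>k. y (s k)) \<longlonglongrightarrow> u"
    using tendsto_snd[OF l] by (simp add: u_def o_def)
  note y_nth_lim = tendsto_vec_nth[OF y_lim]
  have "1 / R \<le> u $ i" for i
    using y_bounds by (intro LIMSEQ_le_const[OF y_nth_lim]) auto
  then have u: "u \<in> pos_cone"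
    unfolding pos_cone_def using R1 by (auto intro: less_le_trans[of 0 "1 / R"])
  have f_u: "f u $ i = \<rho> $ i * u $ i" for i
  proof (rule LIMSEQ_unique)
    have "(\<lambda>k. f (y (s k))) \<longlonglongrightarrow> f u"
      using continuous_on_tendsto_compose[OF monotone_homogeneous_continuous_on[OF f] y_lim u] y_cone
      by simp
    then show "(\<lambda>k. f (y (s k)) $ i) \<longlonglongrightarrow> f u $ i"
      by (rule tendsto_vec_nth)
    show "(\<lambda>k. f (y (s k)) $ i) \<longlonglongrightarrow> \<rho> $ i * u $ i"
      unfolding f_y by (intro tendsto_mult r_lim y_nth_lim)
  qed
  have \<rho>_le: "\<rho> $ i \<le> \<rho> $ j" for i j
  proof -
    have "(\<lambda>k. root (Suc k) R) \<longlonglongrightarrow> 1"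
      using LIMSEQ_Suc[OF LIMSEQ_root_const[of R]] R1 by simp
    then have "(\<lambda>k. root (Suc (s k)) R) \<longlonglongrightarrow> 1"
      using LIMSEQ_subseq_LIMSEQ[OF _ s] by (fastforce simp: o_def)
    then have "(\<lambda>k. root (Suc (s k)) R * r (s k) $ j) \<longlonglongrightarrow> 1 * \<rho> $ j"
      by (intro tendsto_mult r_lim)
    then have "\<rho> $ i \<le> 1 * \<rho> $ j"
      by (rule LIMSEQ_le[OF r_lim]) (use r_R in blast)
    then show ?thesis
      by simp
  qed
  have "m \<le> \<rho> $ i0"
    using r by (intro LIMSEQ_le_const[OF r_lim]) auto
  then have "0 < \<rho> $ i0"
    using m(1) by simp
  moreover have "f u = \<rho> $ i0 *\<^sub>R u"
    using f_u \<rho>_le by (simp add: vec_eq_iff order_antisym)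
  ultimately show ?thesis
    unfolding has_eigenvector_def using u by blast
qed

lemma eigenvector_imp_growth_rate:
  fixes h :: "real ^ 'n \<Rightarrow> real ^ 'n"
  assumes h: "monotone_homogeneous h" and eig: "has_eigenvector h"
  shows "uniform_growth_rate h"
proof -
  obtain u c where u: "u \<in> pos_cone" and c: "0 < c" and hu: "h u = c *\<^sub>R u"
    using eig by (auto simp: has_eigenvector_def)
  have "(\<lambda>k. ((h ^^ k) x $ i) powr (1 / real k)) \<longlonglongrightarrow> c" if x: "x \<in> pos_cone" for x i
  proof -
    obtain a b where ab: "0 < a" "0 < b" "a *\<^sub>R u \<le> x" "x \<le> b *\<^sub>R u"
      using pos_cone_comparable[OF x u] by blast
    have bounds: "(a * c ^ k) *\<^sub>R u \<le> (h ^^ k) x \<and> (h ^^ k) x \<le> (b * c ^ k) *\<^sub>R u" for k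
    proof (induction k)
      case 0
      then show ?case
        using ab by simp
    next
      case (Suc k)
      have "(a * c ^ k) *\<^sub>R h u \<le> h ((h ^^ k) x)" "h ((h ^^ k) x) \<le> (b * c ^ k) *\<^sub>R h u"
        using Suc ab c u monotone_homogeneous_funpow_in_cone[OF h x]
        by (auto intro!: monotone_homogeneous_scaled_mono[OF h])
      then show ?case
        by (simp add: hu ac_simps)
    qed
    have lim: "(\<lambda>k. (d * c ^ k * u $ i) powr (1 / real k)) \<longlonglongrightarrow> c" if d: "0 < d" for d
    proof -
      have du: "0 < d * u $ i"
        using d in_pos_coneD[OF u] by simp
      have "(\<lambda>k. (d * u $ i) powr (1 / real k) * c) \<longlonglongrightarrow> (d * u $ i) powr 0 * c"
        using du by (intro tendsto_intros lim_1_over_n) auto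
      moreover have "(d * u $ i) powr 0 * c = c"
        using less_imp_neq[OF du] by (subst powr_zero_eq_one) auto
      ultimately have "(\<lambda>k. (d * u $ i) powr (1 / real k) * c) \<longlonglongrightarrow> c"
        by (simp only:)
      moreover have "eventually (\<lambda>k. (d * u $ i) powr (1 / real k) * c =
          (d * c ^ k * u $ i) powr (1 / real k)) sequentially"
        using eventually_gt_at_top[of 0]
      proof eventually_elim
        case (elim k)
        have "(d * c ^ k * u $ i) powr (1 / real k) = ((d * u $ i) * c powr real k) powr (1 / real k)"
          using c by (simp add: powr_realpow ac_simps)
        also have "\<dots> = (d * u $ i) powr (1 / real k) * (c powr real k) powr (1 / real k)"
          using du by (simp add: powr_mult)
        also have "(c powr real k) powr (1 / real k) = c"
          using elim c by (simp add: powr_powr)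
        finally show ?case
          by simp
      qed
      ultimately show ?thesis
        by (rule Lim_transform_eventually)
    qed
    show ?thesis
    proof (rule tendsto_sandwich[OF _ _ lim[OF ab(1)] lim[OF ab(2)]])
      have "0 \<le> a * c ^ k * u $ i" for k
        using ab(1) c in_pos_coneD[OF u, of i] by simp
      then show "eventually (\<lambda>k. (a * c ^ k * u $ i) powr (1 / real k) \<le> ((h ^^ k) x $ i) powr (1 / real k)) sequentially"
        using bounds by (intro always_eventually allI powr_mono2) (auto simp: less_eq_vec_def)
      show "eventually (\<lambda>k. ((h ^^ k) x $ i) powr (1 / real k) \<le> (b * c ^ k * u $ i) powr (1 / real k)) sequentially"
        using bounds in_pos_coneD[OF monotone_homogeneous_funpow_in_cone[OF h x], of _ i]
        by (intro always_eventually allI powr_mono2) (auto simp: less_eq_vec_def less_imp_le)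
    qed
  qed
  then show ?thesis
    unfolding uniform_growth_rate_def by blast
qed

section \<open>Diagonal scalings\<close>

lemma positive_diagonal_mult_nth:
  fixes D :: "real ^ 'n ^ 'n"
  assumes "positive_diagonal D"
  shows "(D *v x) $ i = D $ i $ i * x $ i"
proof -
  have "(\<Sum>j\<in>UNIV. D $ i $ j * x $ j) = (\<Sum>j\<in>UNIV. if j = i then D $ i $ i * x $ i else 0)"
    using assms by (intro sum.cong) (auto simp: positive_diagonal_def)
  then show ?thesis
    by (simp add: matrix_vector_mult_def)
qed

lemma monotone_homogeneous_diagonal:
  fixes f :: "real ^ 'n \<Rightarrow> real ^ 'n"
  assumes f: "monotone_homogeneous f" and D: "positive_diagonal D"
  shows "monotone_homogeneous (\<lambda>x. D *v f x)"
proof -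
  have D_pos: "0 < D $ i $ i" for i
    using D by (simp add: positive_diagonal_def)
  show ?thesis
    unfolding monotone_homogeneous_def
  proof (intro conjI funcsetI mono_onI ballI allI impI)
    fix x :: "real ^ 'n"
    assume x: "x \<in> pos_cone"
    show "D *v f x \<in> pos_cone"
      using in_pos_coneD[OF monotone_homogeneous_in_cone[OF f x]] D_pos
      by (simp add: pos_cone_def positive_diagonal_mult_nth[OF D])
    show "D *v f (c *\<^sub>R x) = c *\<^sub>R (D *v f x)" if "0 < c" for c
      using that by (simp add: monotone_homogeneous_scale[OF f x] vec_eq_iff positive_diagonal_mult_nth[OF D])
    show "D *v f x \<le> D *v f y" if "y \<in> pos_cone" "x \<le> y" for y
      using monotone_homogeneous_mono[OF f x that] D_pos
      by (simp add: less_eq_vec_def positive_diagonal_mult_nth[OF D])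
  qed
qed

lemma uniform_perturbation_diagonal:
  fixes f :: "real ^ 'n \<Rightarrow> real ^ 'n"
  assumes f: "monotone_homogeneous f" and D: "positive_diagonal D"
  shows "uniform_perturbation f (\<lambda>x. D *v f x)"
proof -
  have d: "(\<chi> i. D $ i $ i) \<in> pos_cone"
    using D by (simp add: positive_diagonal_def pos_cone_def)
  obtain m M where m: "0 < m" "\<And>i. m \<le> D $ i $ i" and M: "0 < M" "\<And>i. D $ i $ i \<le> M"
    using pos_cone_bounds[OF d] by auto
  have "1 \<le> M / m"
    using order_trans[OF m(2) M(2)] m(1) by simp
  moreover have "m *\<^sub>R f x \<le> D *v f x \<and> D *v f x \<le> M *\<^sub>R f x" if "x \<in> pos_cone" for x
    using in_pos_coneD[OF monotone_homogeneous_in_cone[OF f that]] m M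
    by (simp add: less_eq_vec_def positive_diagonal_mult_nth[OF D] less_imp_le)
  ultimately show ?thesis
    unfolding uniform_perturbation_def using m(1) M(1) by (intro exI[of _ "M / m"]) blast
qed

text \<open>
  On a dominion of Min the iterates of \<open>f\<close> grow at most geometrically, whatever happens
  elsewhere, and on a dominion of Max at least geometrically. On disjoint dominions a diagonal
  matrix can rescale these two growth rates independently so as to separate them, here to at
  most \<open>1\<close> on the first and at least \<open>2\<close> on the second.
\<close>

lemma disjoint_dominions_imp_no_growth_rate:
  fixes f :: "real ^ 'n \<Rightarrow> real ^ 'n"
  assumes f: "monotone_homogeneous f"
    and K: "min_dominion f K" and J: "max_dominion f J" and disj: "K \<inter> J = {}"
  shows "\<exists>D. positive_diagonal D \<and> \<not> uniform_growth_rate (\<lambda>x. D *v f x)"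
proof -
  have "\<forall>i\<in>K. \<exists>C. \<forall>x\<in>pos_cone. (\<forall>j\<in>K. x $ j \<le> 1) \<longrightarrow> f x $ i \<le> C"
    using K by (simp add: min_dominion_iff[OF f] min_actions_iff[OF f])
  then obtain C where C: "\<And>i x. i \<in> K \<Longrightarrow> x \<in> pos_cone \<Longrightarrow> \<forall>j\<in>K. x $ j \<le> 1 \<Longrightarrow> f x $ i \<le> C i"
    by metis
  have "\<forall>i\<in>J. \<exists>c>0. \<forall>x\<in>pos_cone. (\<forall>j\<in>J. 1 \<le> x $ j) \<longrightarrow> c \<le> f x $ i"
    using J by (simp add: max_dominion_iff[OF f] max_actions_iff[OF f])
  then obtain c where c_pos: "\<And>i. i \<in> J \<Longrightarrow> 0 < c i"
    and c: "\<And>i x. i \<in> J \<Longrightarrow> x \<in> pos_cone \<Longrightarrow> \<forall>j\<in>J. 1 \<le> x $ j \<Longrightarrow> c i \<le> f x $ i"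
    by metis
  have C_pos: "0 < C i" if "i \<in> K" for i
    using C[OF that one_in_pos_cone] in_pos_coneD[OF monotone_homogeneous_in_cone[OF f one_in_pos_cone], of i]
    by simp
  define d where "d i = (if i \<in> K then 1 / C i else if i \<in> J then 2 / c i else 1)" for i
  define D :: "real ^ 'n ^ 'n" where "D = (\<chi> i j. if i = j then d i else 0)"
  define h where "h x = D *v f x" for x
  have D: "positive_diagonal D"
    using C_pos c_pos by (simp add: positive_diagonal_def D_def d_def)
  have h: "monotone_homogeneous h"
    unfolding h_def by (rule monotone_homogeneous_diagonal[OF f D])
  have h_nth: "h x $ i = d i * f x $ i" for x i
    by (simp add: h_def positive_diagonal_mult_nth[OF D]) (simp add: D_def)
  note iter_cone = monotone_homogeneous_funpow_in_cone[OF h one_in_pos_cone]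
  have upper: "\<forall>i\<in>K. (h ^^ k) 1 $ i \<le> 1" for k
  proof (induction k)
    case (Suc k)
    show ?case
    proof
      fix i
      assume i: "i \<in> K"
      have "f ((h ^^ k) 1) $ i \<le> C i"
        using C[OF i iter_cone] Suc by blast
      then show "(h ^^ Suc k) 1 $ i \<le> 1"
        using i C_pos[OF i] by (simp add: h_nth d_def)
    qed
  qed simp
  have lower: "\<forall>i\<in>J. 2 ^ k \<le> (h ^^ k) 1 $ i" for k
  proof (induction k)
    case (Suc k)
    show ?case
    proof
      fix i
      assume i: "i \<in> J"
      then have "i \<notin> K"
        using disj by blast
      let ?x = "inverse (2 ^ k) *\<^sub>R (h ^^ k) 1"
      have "?x \<in> pos_cone"
        by (intro scaleR_in_pos_cone iter_cone) simp
      moreover have "\<forall>j\<in>J. 1 \<le> ?x $ j"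
        using Suc by (simp add: field_simps)
      ultimately have "c i \<le> f ?x $ i"
        using c i by blast
      also have "\<dots> = inverse (2 ^ k) * f ((h ^^ k) 1) $ i"
        by (simp add: monotone_homogeneous_scale[OF f iter_cone])
      finally have "2 ^ k * c i \<le> f ((h ^^ k) 1) $ i"
        by (simp add: field_simps)
      then show "2 ^ Suc k \<le> (h ^^ Suc k) 1 $ i"
        using i \<open>i \<notin> K\<close> c_pos[OF i] by (simp add: h_nth d_def field_simps)
    qed
  qed simp
  obtain i j where i: "i \<in> K" and j: "j \<in> J"
    using K J by (auto simp: min_dominion_def max_dominion_def)
  have "\<not> uniform_growth_rate h"
  proof
    assume "uniform_growth_rate h"
    then obtain L where L: "\<And>i. (\<lambda>k. ((h ^^ k) 1 $ i) powr (1 / real k)) \<longlonglongrightarrow> L"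
      unfolding uniform_growth_rate_def using one_in_pos_cone by blast
    have "((h ^^ k) 1 $ i) powr (1 / real k) \<le> 1" for k
      using powr_mono2[of "1 / real k" "(h ^^ k) 1 $ i" 1] upper i in_pos_coneD[OF iter_cone, of k i]
      by simp
    then have "L \<le> 1"
      by (intro LIMSEQ_le_const2[OF L]) blast
    moreover have "2 \<le> ((h ^^ k) 1 $ j) powr (1 / real k)" if "1 \<le> k" for k
    proof -
      have "2 = (2 powr real k) powr (1 / real k)"
        using that by (simp add: powr_powr)
      also have "\<dots> = (2 ^ k) powr (1 / real k)"
        by (simp add: powr_realpow)
      also have "\<dots> \<le> ((h ^^ k) 1 $ j) powr (1 / real k)"
        using lower j by (intro powr_mono2) auto
      finally show ?thesis .
    qed
    then have "2 \<le> L"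
      by (intro LIMSEQ_le_const[OF L]) blast
    ultimately show False
      by simp
  qed
  with D show ?thesis
    unfolding h_def by blast
qed

theorem theorem1p2:
  fixes f :: "real ^ 'n \<Rightarrow> real ^ 'n"
  assumes "monotone_homogeneous f"
  defines "P1 \<equiv> \<not> (\<exists>\<Delta> \<Delta>'. min_dominion f \<Delta> \<and> max_dominion f \<Delta>' \<and> \<Delta> \<inter> \<Delta>' = {})"
    and "P2 \<equiv> \<forall>a>0. \<forall>b>0. hilbert_bounded (slice_space f a b)"
    and "P3 \<equiv> \<forall>D. positive_diagonal D \<longrightarrow> has_eigenvector (\<lambda>x. D *v f x)"
    and "P4 \<equiv> \<forall>D. positive_diagonal D \<longrightarrow> uniform_growth_rate (\<lambda>x. D *v f x)"
    and "P5 \<equiv> \<forall>g. monotone_homogeneous g \<and> uniform_perturbation f g \<longrightarrow> has_eigenvector g"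
    and "P6 \<equiv> \<forall>g. monotone_homogeneous g \<and> uniform_perturbation f g \<longrightarrow> uniform_growth_rate g"
  shows "(P1 \<longleftrightarrow> P2) \<and> (P1 \<longleftrightarrow> P3) \<and> (P1 \<longleftrightarrow> P4) \<and> (P1 \<longleftrightarrow> P5) \<and> (P1 \<longleftrightarrow> P6)"
proof -
  note f = assms(1)
  note diagonal = monotone_homogeneous_diagonal[OF f] uniform_perturbation_diagonal[OF f]
  have "P1 \<Longrightarrow> P2"
    unfolding P1_def P2_def bounded_slices_iff[symmetric] bounded_slices_def
    using unbounded_slice_gives_disjoint_dominions[OF f] by blast
  moreover have "P2 \<Longrightarrow> P5"
    unfolding P2_def P5_def bounded_slices_iff[symmetric]
    using bounded_slices_perturbation[OF f] bounded_slices_imp_eigenvector by blast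
  moreover have "P5 \<Longrightarrow> P3"
    unfolding P5_def P3_def using diagonal by blast
  moreover have "P3 \<Longrightarrow> P4"
    unfolding P3_def P4_def using diagonal(1) eigenvector_imp_growth_rate by blast
  moreover have "P5 \<Longrightarrow> P6"
    unfolding P5_def P6_def using eigenvector_imp_growth_rate by blast
  moreover have "P6 \<Longrightarrow> P4"
    unfolding P6_def P4_def using diagonal by blast
  moreover have "P4 \<Longrightarrow> P1"
    unfolding P4_def P1_def using disjoint_dominions_imp_no_growth_rate[OF f] by blast
  ultimately show ?thesis
    by blast
qed

end
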